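(* Let $P_{X,Y}$ be a joint probability distribution on $\{-1,1\}^2$, and let $\mathcal{U}=\mathcal{V}=\mathcal{Z}=\{-1,1\}$. Then $\mathcal{P}_{EA}(P_{X,Y},\mathcal{U},\mathcal{V},\mathcal{Z})=\mathcal{P}_{CR}(P_{X,Y},\mathcal{U},\mathcal{V})$.
   Context: Let $P_{X,Y}$ be a distribution on $\{-1,1\}^2$, and let $\mathcal{U},\mathcal{V}$ be finite sets. For $d\in\mathbb{N}$, $(X^d,Y^d)=((X_1,Y_1),\dots,(X_d,Y_d))$ is i.i.d. with law $P_{X,Y}$. A stochastic function is a function whose output may also depend on private randomness, independent of everything else (in particular, the private randomness of Alice and that of Bob are independent); equivalently, a Markov kernel from inputs to outputs. $d_{TV}$ is total variation distance. Entanglement-assisted simulation (EA-NISS). The Bell state is $|\Phi^+\rangle=\frac{1}{\sqrt2}(|00\rangle+|11\rangle)\in\mathbb{C}^2\otimes\mathbb{C}^2$. A measurement with finite outcome set $\mathcal{Z}$ is a family $(\Lambda_z)_{z\in\mathcal{Z}}$ of positive semidefinite Hermitian $2\times2$ matrices with $\sum_z\Lambda_z=\mathbb{I}$. If Alice and Bob apply measurements $(\Lambda_{1,z})_z$ and $(\Lambda_{2,z})_z$ to their halves of $|\Phi^+\rangle$, their outcomes $(Z_1,Z_2)$ have law $P(Z_1=z_1,Z_2=z_2)=\langle\Phi^+|\Lambda_{1,z_1}\otimes\Lambda_{2,z_2}|\Phi^+\rangle$, and $(Z_1,Z_2)$ is independent of $(X^d,Y^d)$. For a finite set $\mathcal{Z}$,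 $\mathcal{P}_{EA}(P_{X,Y},\mathcal{U},\mathcal{V},\mathcal{Z})$ is the set of distributions $Q_{U,V}$ on $\mathcal{U}\times\mathcal{V}$ for which there exist, for each $d\in\mathbb{N}$, measurements $(\Lambda_{d,1,z})_{z\in\mathcal{Z}}$, $(\Lambda_{d,2,z})_{z\in\mathcal{Z}}$ with outcomes $Z_{1,d},Z_{2,d}$, and (possibly stochastic) functions $f_d:\mathcal{Z}\times\{-1,1\}^d\to\mathcal{U}$, $g_d:\mathcal{Z}\times\{-1,1\}^d\to\mathcal{V}$, such that the law $P^{(d)}$ of $(f_d(Z_{1,d},X^d),g_d(Z_{2,d},Y^d))$ satisfies $\lim_{d\to\infty}d_{TV}(P^{(d)},Q_{U,V})=0$. Common-randomness simulation (CR-NISS). $\mathcal{P}_{CR}(P_{X,Y},\mathcal{U},\mathcal{V})$ is the set of distributions $Q_{U,V}$ on $\mathcal{U}\times\mathcal{V}$ for which there exist, for each $d\in\mathbb{N}$, (possibly stochastic) functions $f_d:\{-1,1\}^{d+1}\to\mathcal{U}$ and $g_d:\{-1,1\}^{d+1}\to\mathcal{V}$ such that the law $P^{(d)}$ of $(f_d(Z,X^d),g_d(Z,Y^d))$ satisfies $\lim_{d\to\infty}d_{TV}(P^{(d)},Q_{U,V})=0$, where $Z$ is uniform on $\{-1,1\}$ and independent of $(X^d,Y^d)$. *)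

theory Defs
  imports "HOL-Probability.Probability"
begin

definition cinner_vec :: "complex ^ 'n \<Rightarrow> complex ^ 'n \<Rightarrow> complex" where
  "cinner_vec v w = (\<Sum>i\<in>UNIV. cnj (v $ i) * w $ i)"

definition hermitian_mat :: "complex ^ 'n ^ 'n \<Rightarrow> bool" where
  "hermitian_mat A \<longleftrightarrow> (\<forall>i j. A $ i $ j = cnj (A $ j $ i))"

text \<open>The quadratic form of a Hermitian matrix is real valued, so \<^term>\<open>Re\<close> drops nothing.\<close>

definition psd_mat :: "complex ^ 'n ^ 'n \<Rightarrow> bool" where
  "psd_mat A \<longleftrightarrow> hermitian_mat A \<and> (\<forall>v. 0 \<le> Re (cinner_vec v (A *v v)))"

definition tensor_mat ::
  "complex ^ 'm ^ 'm \<Rightarrow> complex ^ 'n ^ 'n \<Rightarrow> complex ^ ('m \<times> 'n) ^ ('m \<times> 'n)" where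
  "tensor_mat A B = (\<chi> p q. A $ fst p $ fst q * B $ snd p $ snd q)"

text \<open>The computational basis vectors $|0\rangle, |1\rangle$ are indexed by \<open>1\<close> and \<open>2\<close>,
  the two elements of the type \<^typ>\<open>2\<close>.\<close>

definition bell_state :: "complex ^ (2 \<times> 2)" where
  "bell_state = complex_of_real (1 / sqrt 2) *s (axis (1, 1) 1 + axis (2, 2) 1)"

text \<open>Since \<^term>\<open>sum\<close> vanishes on infinite sets, the outcome set of a measurement is finite.\<close>

definition measurement :: "'z set \<Rightarrow> ('z \<Rightarrow> complex ^ 2 ^ 2) \<Rightarrow> bool" where
  "measurement Z L \<longleftrightarrow> (\<forall>z\<in>Z. psd_mat (L z)) \<and> (\<Sum>z\<in>Z. L z) = mat 1"

definition born_value :: "complex ^ 2 ^ 2 \<Rightarrow> complex ^ 2 ^ 2 \<Rightarrow> complex" where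
  "born_value A B = cinner_vec bell_state (tensor_mat A B *v bell_state)"

definition bell_outcomes ::
  "'z set \<Rightarrow> ('z \<Rightarrow> complex ^ 2 ^ 2) \<Rightarrow> ('z \<Rightarrow> complex ^ 2 ^ 2) \<Rightarrow> ('z \<times> 'z) pmf" where
  "bell_outcomes Z L M = embed_pmf (\<lambda>(z1, z2).
     if z1 \<in> Z \<and> z2 \<in> Z then Re (born_value (L z1) (M z2)) else 0)"

lemma born_value_eq: "born_value A B = (\<Sum>i\<in>UNIV. \<Sum>j\<in>UNIV. A $ i $ j * B $ i $ j) / 2"
proof -
  have *: "complex_of_real (sqrt 2) * complex_of_real (sqrt 2) = 2"
    by (simp flip: of_real_mult)
  have U: "(UNIV :: (2 \<times> 2) set) = {(1,1),(1,2),(2,1),(2,2)}"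
    by (auto simp: UNIV_2 simp flip: UNIV_Times_UNIV)
  show ?thesis
    by (simp add: born_value_def cinner_vec_def matrix_vector_mult_def tensor_mat_def
        bell_state_def axis_def sum_2 U field_simps *)
qed

lemma psd_mat_2:
  assumes "psd_mat (A :: complex ^ 2 ^ 2)"
  obtains a d :: real and b :: complex where
    "A $ 1 $ 1 = of_real a" "A $ 2 $ 2 = of_real d" "A $ 1 $ 2 = b" "A $ 2 $ 1 = cnj b"
    "0 \<le> a" "0 \<le> d" "(cmod b)\<^sup>2 \<le> a * d"
proof -
  define a where "a = Re (A $ 1 $ 1)"
  define d where "d = Re (A $ 2 $ 2)"
  define b where "b = A $ 1 $ 2"
  have h: "A $ i $ j = cnj (A $ j $ i)" for i j
    using assms unfolding psd_mat_def hermitian_mat_def by blast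
  have 11: "A $ 1 $ 1 = of_real a" and 22: "A $ 2 $ 2 = of_real d"
    using h[of 1 1] h[of 2 2] by (auto simp: a_def d_def complex_eq_iff)
  have 21: "A $ 2 $ 1 = cnj b" using h[of 2 1] by (simp add: b_def)
  have q: "0 \<le> a * (cmod x)\<^sup>2 + d * (cmod y)\<^sup>2 + 2 * Re (cnj x * b * y)" for x y
  proof -
    define v :: "complex ^ 2" where "v = (\<chi> i. if i = 1 then x else y)"
    have "cinner_vec v (A *v v) =
        a * (cnj x * x) + d * (cnj y * y) + (cnj x * b * y + cnj (cnj x * b * y))"
      by (simp add: cinner_vec_def matrix_vector_mult_def sum_2 v_def 11 22 21
          flip: b_def) (simp add: algebra_simps)
    also have "\<dots> = of_real (a * (cmod x)\<^sup>2 + d * (cmod y)\<^sup>2 + 2 * Re (cnj x * b * y))"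
      by (simp only: complex_add_cnj mult.commute[of "cnj _"] flip: complex_norm_square) simp
    finally have "Re (cinner_vec v (A *v v)) =
        a * (cmod x)\<^sup>2 + d * (cmod y)\<^sup>2 + 2 * Re (cnj x * b * y)" by simp
    then show ?thesis using assms unfolding psd_mat_def by metis
  qed
  have a0: "0 \<le> a" using q[of 1 0] by simp
  have d0: "0 \<le> d" using q[of 0 1] by simp
  have Q: "0 \<le> a * t\<^sup>2 * (cmod b)\<^sup>2 + d - 2 * t * (cmod b)\<^sup>2" for t :: real
  proof -
    have "cnj (- of_real t * b) * b * 1 = of_real (- t * (cmod b)\<^sup>2)"
      using complex_norm_square[of b] by (simp add: mult.commute)
    then have "Re (cnj (- of_real t * b) * b * 1) = - t * (cmod b)\<^sup>2"
      by (simp only: Re_complex_of_real)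
    then show ?thesis
      using q[of "- of_real t * b" 1]
      by (simp only: norm_mult norm_minus_cancel norm_of_real norm_one power_mult_distrib
          power2_abs) (simp add: algebra_simps)
  qed
  have "(cmod b)\<^sup>2 \<le> a * d"
  proof (cases "a = 0")
    case True
    show ?thesis
    proof (rule ccontr)
      assume "\<not> ?thesis"
      then have p: "(cmod b)\<^sup>2 > 0" using True by simp
      have "0 \<le> d - 2 * ((d + 1) / (cmod b)\<^sup>2) * (cmod b)\<^sup>2"
        using Q[of "(d + 1) / (cmod b)\<^sup>2"] True by simp
      with p d0 show False by simp
    qed
  next
    case False
    then have "a > 0" using a0 by simp
    then show ?thesis using Q[of "1 / a"]
      by (simp add: power2_eq_square field_simps)
  qed
  then show thesis using that[of a d b] 11 22 21 a0 d0 b_def by simp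
qed

lemma born_value_real_nonneg:
  assumes "psd_mat A" "psd_mat B"
  shows "Im (born_value A B) = 0" "0 \<le> Re (born_value A B)"
proof -
  obtain a d b where A: "A $ 1 $ 1 = of_real a" "A $ 2 $ 2 = of_real d"
      "A $ 1 $ 2 = b" "A $ 2 $ 1 = cnj b" "0 \<le> a" "0 \<le> d" "(cmod b)\<^sup>2 \<le> a * d"
    using psd_mat_2[OF assms(1)] by blast
  obtain a' d' b' where B: "B $ 1 $ 1 = of_real a'" "B $ 2 $ 2 = of_real d'"
      "B $ 1 $ 2 = b'" "B $ 2 $ 1 = cnj b'" "0 \<le> a'" "0 \<le> d'" "(cmod b')\<^sup>2 \<le> a' * d'"
    using psd_mat_2[OF assms(2)] by blast
  have "born_value A B = (a * a' + d * d' + (b * b' + cnj (b * b'))) / 2"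
    by (simp add: born_value_eq sum_2 A B)
  also have "\<dots> = of_real ((a * a' + d * d') / 2 + Re (b * b'))"
    by (simp only: complex_add_cnj) simp
  finally have e: "born_value A B = of_real ((a * a' + d * d') / 2 + Re (b * b'))" .
  then show "Im (born_value A B) = 0" by simp
  have "(2 * cmod (b * b'))\<^sup>2 = 4 * ((cmod b)\<^sup>2 * (cmod b')\<^sup>2)"
    by (simp add: norm_mult power_mult_distrib)
  also have "\<dots> \<le> 4 * ((a * d) * (a' * d'))"
    using A B by (intro mult_left_mono mult_mono) auto
  also have "\<dots> \<le> (a * a' + d * d')\<^sup>2"
    using zero_le_power2[of "a * a' - d * d'"] by (simp add: power2_eq_square algebra_simps)
  finally have "2 * cmod (b * b') \<le> a * a' + d * d'"
    by (rule power2_le_imp_le) (intro add_nonneg_nonneg mult_nonneg_nonneg A(5,6) B(5,6))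
  moreover have aux: "0 \<le> s / 2 + r" if "2 * c \<le> s" "- r \<le> c" for c r s :: real
    using that by linarith
  moreover have "- Re (b * b') \<le> cmod (b * b')"
    using abs_Re_le_cmod[of "b * b'"] by linarith
  ultimately show "0 \<le> Re (born_value A B)"
    unfolding e Re_complex_of_real using aux by blast
qed

lemma sum_born_value:
  assumes "measurement Z L" "measurement Z M"
  shows "(\<Sum>z1\<in>Z. \<Sum>z2\<in>Z. born_value (L z1) (M z2)) = 1"
proof -
  have "(\<Sum>z1\<in>Z. \<Sum>z2\<in>Z. born_value (L z1) (M z2)) =
      born_value (\<Sum>z\<in>Z. L z) (\<Sum>z\<in>Z. M z)"
    by (simp add: born_value_eq sum_2 sum_product add_divide_distrib sum.distrib
        flip: sum_divide_distrib)
  also have "\<dots> = born_value (mat 1) (mat 1)"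
    using assms by (simp add: measurement_def)
  also have "\<dots> = 1" by (simp add: born_value_eq sum_2 mat_def)
  finally show ?thesis .
qed

text \<open>The Born rule yields a probability mass function, so \<^const>\<open>embed_pmf\<close> above is well defined.\<close>

lemma pmf_bell_outcomes:
  assumes L: "measurement Z L" and M: "measurement Z M"
  shows "complex_of_real (pmf (bell_outcomes Z L M) (z1, z2)) =
    (if z1 \<in> Z \<and> z2 \<in> Z then born_value (L z1) (M z2) else 0)"
proof -
  define h where "h = (\<lambda>(z1, z2).
     if z1 \<in> Z \<and> z2 \<in> Z then Re (born_value (L z1) (M z2)) else 0)"
  have psd: "psd_mat (L z)" "psd_mat (M z)" if "z \<in> Z" for z
    using L M that by (auto simp: measurement_def)
  have fin: "finite Z"
  proof (rule ccontr)
    assume "infinite Z"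
    then have "(mat 1 :: complex ^ 2 ^ 2) = 0" using L by (simp add: measurement_def)
    then have "(mat 1 :: complex ^ 2 ^ 2) $ 1 $ 1 = 0" by simp
    then show False by (simp add: mat_def)
  qed
  have h0: "0 \<le> h x" for x
    by (auto simp: h_def psd born_value_real_nonneg split: prod.split)
  have "(\<integral>\<^sup>+ x. ennreal (h x) \<partial>count_space UNIV) = (\<Sum>x\<in>Z \<times> Z. ennreal (h x))"
    using fin by (intro nn_integral_count_space') (auto simp: h_def split: if_splits)
  also have "\<dots> = ennreal (\<Sum>x\<in>Z \<times> Z. h x)"
    using h0 by (intro sum_ennreal) auto
  also have "(\<Sum>x\<in>Z \<times> Z. h x) = (\<Sum>z1\<in>Z. \<Sum>z2\<in>Z. Re (born_value (L z1) (M z2)))"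
    by (simp add: sum.cartesian_product h_def) (intro sum.cong; auto)
  also have "\<dots> = Re (\<Sum>z1\<in>Z. \<Sum>z2\<in>Z. born_value (L z1) (M z2))" by simp
  also have "\<dots> = 1" by (simp only: sum_born_value[OF L M]) simp
  finally have "(\<integral>\<^sup>+ x. ennreal (h x) \<partial>count_space UNIV) = 1" by simp
  then have "pmf (bell_outcomes Z L M) (z1, z2) = h (z1, z2)"
    unfolding bell_outcomes_def h_def[symmetric] using h0 by (intro pmf_embed_pmf) auto
  then show ?thesis
    using born_value_real_nonneg(1)[OF psd] by (auto simp: h_def complex_eq_iff)
qed

definition tv_dist :: "'a pmf \<Rightarrow> 'a pmf \<Rightarrow> real" where
  "tv_dist p q = (SUP A. \<bar>measure_pmf.prob p A - measure_pmf.prob q A\<bar>)"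

definition sign_cube :: "nat \<Rightarrow> int list set" where
  "sign_cube d = {xs. length xs = d \<and> set xs \<subseteq> {-1, 1}}"

text \<open>Markov kernels from \<open>A\<close> to \<open>B\<close>; the values outside \<open>A\<close> are irrelevant.\<close>

definition stochastic_fun :: "'a set \<Rightarrow> 'b set \<Rightarrow> ('a \<Rightarrow> 'b pmf) \<Rightarrow> bool" where
  "stochastic_fun A B k \<longleftrightarrow> (\<forall>a\<in>A. set_pmf (k a) \<subseteq> B)"

text \<open>The sample \<^term>\<open>xy\<close> is the list $((x_1,y_1),\dots,(x_d,y_d))$. The use of
  \<^const>\<open>pair_pmf\<close> expresses that the private randomness of the two parties is independent.\<close>

definition EA_law :: "(int \<times> int) pmf \<Rightarrow> 'z set \<Rightarrow> nat \<Rightarrow>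
    ('z \<Rightarrow> complex ^ 2 ^ 2) \<Rightarrow> ('z \<Rightarrow> complex ^ 2 ^ 2) \<Rightarrow>
    ('z \<times> int list \<Rightarrow> 'u pmf) \<Rightarrow> ('z \<times> int list \<Rightarrow> 'v pmf) \<Rightarrow> ('u \<times> 'v) pmf" where
  "EA_law P Z d L M f g =
     bind_pmf (replicate_pmf d P) (\<lambda>xy.
     bind_pmf (bell_outcomes Z L M) (\<lambda>(z1, z2).
       pair_pmf (f (z1, map fst xy)) (g (z2, map snd xy))))"

definition P_EA :: "(int \<times> int) pmf \<Rightarrow> 'u set \<Rightarrow> 'v set \<Rightarrow> 'z set \<Rightarrow> ('u \<times> 'v) pmf set" where
  "P_EA P U V Z = {Q. set_pmf Q \<subseteq> U \<times> V \<and>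
     (\<exists>L M f g.
        (\<forall>d. measurement Z (L d) \<and> measurement Z (M d) \<and>
             stochastic_fun (Z \<times> sign_cube d) U (f d) \<and>
             stochastic_fun (Z \<times> sign_cube d) V (g d)) \<and>
        (\<lambda>d. tv_dist (EA_law P Z d (L d) (M d) (f d) (g d)) Q) \<longlonglongrightarrow> 0)}"

definition CR_law :: "(int \<times> int) pmf \<Rightarrow> nat \<Rightarrow>
    (int list \<Rightarrow> 'u pmf) \<Rightarrow> (int list \<Rightarrow> 'v pmf) \<Rightarrow> ('u \<times> 'v) pmf" where
  "CR_law P d f g =
     bind_pmf (replicate_pmf d P) (\<lambda>xy.
     bind_pmf (pmf_of_set {-1, 1}) (\<lambda>z.
       pair_pmf (f (z # map fst xy)) (g (z # map snd xy))))"

definition P_CR :: "(int \<times> int) pmf \<Rightarrow> 'u set \<Rightarrow> 'v set \<Rightarrow> ('u \<times> 'v) pmf set" where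
  "P_CR P U V = {Q. set_pmf Q \<subseteq> U \<times> V \<and>
     (\<exists>f g.
        (\<forall>d. stochastic_fun (sign_cube (d + 1)) U (f d) \<and>
             stochastic_fun (sign_cube (d + 1)) V (g d)) \<and>
        (\<lambda>d. tv_dist (CR_law P d (f d) (g d)) Q) \<longlonglongrightarrow> 0)}"

end

theory Submission
  imports Defs
begin

text \<open>A two-outcome measurement of a qubit is a projective measurement followed by classical noise,
  and two projective measurements of the Bell state yield uniform bits with some correlation
  \<open>\<rho>\<close>; such bits arise from one shared uniform bit, sent through a binary symmetric channel on one
  side. The noise is then absorbed into the private randomness. Conversely, measuring both halves
  in the computational basis yields a shared uniform bit. Hence the two models generate the
  same laws already for each fixed \<open>d\<close>.\<close>

definition sign_pmf :: "real \<Rightarrow> int pmf" where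
  "sign_pmf p = map_pmf (\<lambda>b. if b then 1 else - 1) (bernoulli_pmf p)"

lemma set_sign_pmf: "set_pmf (sign_pmf p) \<subseteq> {- 1, 1}"
  by (auto simp: sign_pmf_def)

lemma pmf_sign_pmf:
  assumes "0 \<le> p" "p \<le> 1"
  shows "pmf (sign_pmf p) z = (if z = 1 then p else if z = - 1 then 1 - p else 0)"
proof -
  have "inj (\<lambda>b. if b then 1 else - 1 :: int)"
    by (auto simp: inj_on_def split: if_splits)
  from pmf_map_inj'[OF this, of "bernoulli_pmf p" True] pmf_map_inj'[OF this, of "bernoulli_pmf p" False]
  have "pmf (sign_pmf p) 1 = p" "pmf (sign_pmf p) (- 1) = 1 - p"
    using assms by (simp_all add: sign_pmf_def)
  moreover have "pmf (sign_pmf p) z = 0" if "z \<noteq> 1" "z \<noteq> - 1"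
    using that set_sign_pmf[of p] by (auto simp: set_pmf_iff)
  ultimately show ?thesis by auto
qed

lemma pmf_bind_uniform_sign:
  "pmf (bind_pmf (pmf_of_set {- 1, 1 :: int}) F) x = (pmf (F (- 1)) x + pmf (F 1) x) / 2"
  by (simp add: pmf_bind_pmf_of_set)

text \<open>\<open>m\<close> is half the trace and \<open>(Re b, - Im b, \<delta>)\<close> is the Bloch vector of the first effect.\<close>

lemma binary_measurement_bloch:
  assumes "measurement {- 1, 1 :: int} L"
  obtains m \<delta> :: real and b :: complex where
    "L 1 $ 1 $ 1 = of_real (m + \<delta>)" "L 1 $ 2 $ 2 = of_real (m - \<delta>)"
    "L 1 $ 1 $ 2 = b" "L 1 $ 2 $ 1 = cnj b"
    "L (- 1) $ 1 $ 1 = of_real (1 - m - \<delta>)" "L (- 1) $ 2 $ 2 = of_real (1 - m + \<delta>)"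
    "L (- 1) $ 1 $ 2 = - b" "L (- 1) $ 2 $ 1 = - cnj b"
    "sqrt (\<delta>\<^sup>2 + (cmod b)\<^sup>2) \<le> m" "sqrt (\<delta>\<^sup>2 + (cmod b)\<^sup>2) \<le> 1 - m"
proof -
  have psd: "psd_mat (L 1)" "psd_mat (L (- 1))"
    using assms by (simp_all add: measurement_def)
  have "L (- 1) + L 1 = mat 1"
    using assms by (simp add: measurement_def)
  then have sum1: "L (- 1) $ i $ j = mat 1 $ i $ j - L 1 $ i $ j" for i j
    by (metis add_diff_cancel_right' vector_add_component)
  obtain a d b where A: "L 1 $ 1 $ 1 = of_real a" "L 1 $ 2 $ 2 = of_real d"
      "L 1 $ 1 $ 2 = b" "L 1 $ 2 $ 1 = cnj b" "0 \<le> a" "0 \<le> d" "(cmod b)\<^sup>2 \<le> a * d"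
    using psd_mat_2[OF psd(1)] by blast
  obtain a' d' b' where B: "L (- 1) $ 1 $ 1 = of_real a'" "L (- 1) $ 2 $ 2 = of_real d'"
      "L (- 1) $ 1 $ 2 = b'" "0 \<le> a'" "0 \<le> d'" "(cmod b')\<^sup>2 \<le> a' * d'"
    using psd_mat_2[OF psd(2)] by blast
  have b': "b' = - b" using sum1[of 1 2] A B by (simp add: mat_def)
  have "complex_of_real a' = of_real (1 - a)" "complex_of_real d' = of_real (1 - d)"
    using sum1[of 1 1] sum1[of 2 2] A B by (simp_all add: mat_def)
  then have ad': "a' = 1 - a" "d' = 1 - d" by (simp_all only: of_real_eq_iff)
  define m where "m = (a + d) / 2"
  define \<delta> where "\<delta> = (a - d) / 2"
  have ad: "a = m + \<delta>" "d = m - \<delta>" by (simp_all add: m_def \<delta>_def field_simps)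
  \<comment> \<open>Since \<open>a * d\<close> is \<open>m\<^sup>2 - \<delta>\<^sup>2\<close>, the
    determinant bound limits the length of the Bloch vector. The complementary effect has the
    negated vector and half trace \<open>1 - m\<close>, which gives the second bound in the same
    way.\<close>
  have "\<delta>\<^sup>2 + (cmod b)\<^sup>2 \<le> m\<^sup>2"
    using A(7) unfolding ad by (simp add: power2_eq_square algebra_simps)
  then have 1: "sqrt (\<delta>\<^sup>2 + (cmod b)\<^sup>2) \<le> m"
    using A(5,6) by (intro real_le_lsqrt) (simp_all add: m_def)
  have "\<delta>\<^sup>2 + (cmod b)\<^sup>2 \<le> (1 - m)\<^sup>2"
    using B(6) unfolding ad' ad b' by (simp add: power2_eq_square algebra_simps)
  then have 2: "sqrt (\<delta>\<^sup>2 + (cmod b)\<^sup>2) \<le> 1 - m"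
    using B(4,5) ad' by (intro real_le_lsqrt) (simp_all add: m_def)
  show thesis
    using that[of m \<delta> b] 1 2 A(1-4) ad sum1 by (simp add: mat_def)
qed

text \<open>Cauchy-Schwarz for two Bloch vectors, one of them reflected in its second coordinate:
  \<open>Re (b * b')\<close> carries no conjugate because the Bell state transposes one
  side.\<close>

lemma bloch_inner_le:
  "\<bar>\<delta> * \<delta>' + Re (b * b')\<bar> \<le> sqrt (\<delta>\<^sup>2 + (cmod b)\<^sup>2) * sqrt (\<delta>'\<^sup>2 + (cmod b')\<^sup>2)"
proof -
  have "\<bar>\<delta> * \<delta>' + Re (b * b')\<bar> \<le> \<bar>\<delta>\<bar> * \<bar>\<delta>'\<bar> + cmod b * cmod b'"
    using abs_Re_le_cmod[of "b * b'"] by (simp add: norm_mult abs_mult[symmetric])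
  also have "\<dots> \<le> sqrt (\<delta>\<^sup>2 + (cmod b)\<^sup>2) * sqrt (\<delta>'\<^sup>2 + (cmod b')\<^sup>2)"
  proof -
    \<comment> \<open>Lagrange's identity: the right side minus the left is the square supplied
      below.\<close>
    have "(\<bar>\<delta>\<bar> * \<bar>\<delta>'\<bar> + cmod b * cmod b')\<^sup>2 \<le> (\<bar>\<delta>\<bar>\<^sup>2 + (cmod b)\<^sup>2) * (\<bar>\<delta>'\<bar>\<^sup>2 + (cmod b')\<^sup>2)"
      using zero_le_power2[of "\<bar>\<delta>\<bar> * cmod b' - \<bar>\<delta>'\<bar> * cmod b"]
      by (simp add: power2_eq_square algebra_simps)
    then show ?thesis
      by (simp add: real_le_rsqrt flip: real_sqrt_mult)
  qed
  finally show ?thesis .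
qed

text \<open>A law on two signs is determined by its marginals and its covariance. Shifting the two
  success probabilities \<open>m\<close> and \<open>m'\<close> by \<open>r\<close> and
  \<open>\<kappa>\<close>, with the common bit as sign, preserves the marginals and contributes
  \<open>r * \<kappa>\<close> to the joint probabilities. It remains to factor the Bell correlation
  \<open>w\<close> in this way with shifts small enough to leave probabilities.\<close>

lemma bell_outcomes_common_bit:
  assumes L: "measurement {- 1, 1 :: int} L" and M: "measurement {- 1, 1 :: int} M"
  obtains k l :: "int \<Rightarrow> int pmf" where
    "\<forall>z. set_pmf (k z) \<subseteq> {- 1, 1}" "\<forall>z. set_pmf (l z) \<subseteq> {- 1, 1}"
    "bell_outcomes {- 1, 1} L M =
       bind_pmf (pmf_of_set {- 1, 1}) (\<lambda>z. pair_pmf (k z) (l z))"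
proof -
  obtain m \<delta> b where A:
    "L 1 $ 1 $ 1 = of_real (m + \<delta>)" "L 1 $ 2 $ 2 = of_real (m - \<delta>)"
    "L 1 $ 1 $ 2 = b" "L 1 $ 2 $ 1 = cnj b"
    "L (- 1) $ 1 $ 1 = of_real (1 - m - \<delta>)" "L (- 1) $ 2 $ 2 = of_real (1 - m + \<delta>)"
    "L (- 1) $ 1 $ 2 = - b" "L (- 1) $ 2 $ 1 = - cnj b"
    "sqrt (\<delta>\<^sup>2 + (cmod b)\<^sup>2) \<le> m" "sqrt (\<delta>\<^sup>2 + (cmod b)\<^sup>2) \<le> 1 - m"
    using binary_measurement_bloch[OF L] .
  obtain m' \<delta>' b' where B:
    "M 1 $ 1 $ 1 = of_real (m' + \<delta>')" "M 1 $ 2 $ 2 = of_real (m' - \<delta>')"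
    "M 1 $ 1 $ 2 = b'" "M 1 $ 2 $ 1 = cnj b'"
    "M (- 1) $ 1 $ 1 = of_real (1 - m' - \<delta>')" "M (- 1) $ 2 $ 2 = of_real (1 - m' + \<delta>')"
    "M (- 1) $ 1 $ 2 = - b'" "M (- 1) $ 2 $ 1 = - cnj b'"
    "sqrt (\<delta>'\<^sup>2 + (cmod b')\<^sup>2) \<le> m'" "sqrt (\<delta>'\<^sup>2 + (cmod b')\<^sup>2) \<le> 1 - m'"
    using binary_measurement_bloch[OF M] .
  define r where "r = sqrt (\<delta>\<^sup>2 + (cmod b)\<^sup>2)"
  define r' where "r' = sqrt (\<delta>'\<^sup>2 + (cmod b')\<^sup>2)"
  define w where "w = \<delta> * \<delta>' + Re (b * b')"
  \<comment> \<open>If \<open>r = 0\<close> then \<open>w = 0\<close>, so the junk value \<open>\<kappa> = 0\<close> is the right one.\<close>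
  define \<kappa> where "\<kappa> = w / r"
  have r: "0 \<le> r" "r \<le> m" "r \<le> 1 - m" and r': "0 \<le> r'" "r' \<le> m'" "r' \<le> 1 - m'"
    using A(9,10) B(9,10) by (simp_all add: r_def r'_def)
  have w: "\<bar>w\<bar> \<le> r * r'"
    using bloch_inner_le[of \<delta> \<delta>' b b'] by (simp add: w_def r_def r'_def)
  have \<kappa>: "r * \<kappa> = w" "\<bar>\<kappa>\<bar> \<le> r'"
    using w r(1) r'(1) by (cases "r = 0"; simp add: \<kappa>_def field_simps abs_mult)+
  \<comment> \<open>The values \<open>m + r\<close> and \<open>m - r\<close> are the eigenvalues of
    \<open>L 1\<close>, so the common bit plays the role of a measurement in its eigenbasis. For
    \<open>r > 0\<close>, \<open>\<kappa>\<close> is the component of the other Bloch vector along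
    the reflected axis, and \<open>l\<close> is the outcome law on the collapsed second
    qubit.\<close>
  define k where "k = (\<lambda>z :: int. sign_pmf (if z = 1 then m + r else m - r))"
  define l where "l = (\<lambda>z :: int. sign_pmf (if z = 1 then m' + \<kappa> else m' - \<kappa>))"
  have k: "pmf (k 1) z = (if z = 1 then m + r else if z = - 1 then 1 - m - r else 0)"
      "pmf (k (- 1)) z = (if z = 1 then m - r else if z = - 1 then 1 - m + r else 0)" for z
    using r by (simp_all add: k_def pmf_sign_pmf)
  have l: "pmf (l 1) z = (if z = 1 then m' + \<kappa> else if z = - 1 then 1 - m' - \<kappa> else 0)"
      "pmf (l (- 1)) z = (if z = 1 then m' - \<kappa> else if z = - 1 then 1 - m' + \<kappa> else 0)" for z
    using r' \<kappa>(2) by (auto simp: l_def pmf_sign_pmf)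
  \<comment> \<open>Independent outcomes would give the products; the correlation \<open>w\<close>
    enters with a plus sign exactly when the outcomes agree.\<close>
  have born:
    "Re (born_value (L 1) (M 1)) = m * m' + r * \<kappa>"
    "Re (born_value (L 1) (M (- 1))) = m * (1 - m') - r * \<kappa>"
    "Re (born_value (L (- 1)) (M 1)) = (1 - m) * m' - r * \<kappa>"
    "Re (born_value (L (- 1)) (M (- 1))) = (1 - m) * (1 - m') + r * \<kappa>"
    unfolding \<kappa>(1) by (simp_all add: born_value_eq sum_2 A(1-8) B(1-8) w_def field_simps)
  have "pmf (bell_outcomes {- 1, 1} L M) x =
      pmf (bind_pmf (pmf_of_set {- 1, 1}) (\<lambda>z. pair_pmf (k z) (l z))) x" for x
  proof -
    obtain z1 z2 where x: "x = (z1, z2)" by (cases x)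
    have "pmf (bell_outcomes {- 1, 1} L M) x =
        (if z1 \<in> {- 1, 1} \<and> z2 \<in> {- 1, 1} then Re (born_value (L z1) (M z2)) else 0)"
      using arg_cong[OF pmf_bell_outcomes[OF L M, of z1 z2], of Re] by (simp add: x)
    \<comment> \<open>In the average over the bit the terms linear in \<open>r\<close> or
      \<open>\<kappa>\<close> cancel, and only \<open>r * \<kappa>\<close> survives.\<close>
    also have "\<dots> = (pmf (k (- 1)) z1 * pmf (l (- 1)) z2 + pmf (k 1) z1 * pmf (l 1) z2) / 2"
      unfolding k l by (auto simp: born) (simp_all add: field_simps)
    also have "\<dots> = pmf (bind_pmf (pmf_of_set {- 1, 1}) (\<lambda>z. pair_pmf (k z) (l z))) x"
      by (simp add: x pmf_bind_uniform_sign pmf_pair)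
    finally show ?thesis .
  qed
  then have "bell_outcomes {- 1, 1} L M =
      bind_pmf (pmf_of_set {- 1, 1}) (\<lambda>z. pair_pmf (k z) (l z))"
    by (rule pmf_eqI)
  then show thesis
    by (rule that[rotated 2]) (simp_all only: k_def l_def set_sign_pmf simp_thms)
qed

text \<open>This absorbs local noise into private randomness. The two sides differ only in the order
  of the independent draws from \<open>q\<close> and \<open>f x\<close>.\<close>

lemma bind_pair_pmf_pair_pmf:
  "bind_pmf (pair_pmf p q) (\<lambda>(x, y). pair_pmf (f x) (g y)) =
    pair_pmf (bind_pmf p f) (bind_pmf q g)"
  unfolding pair_pmf_def
  by (simp add: bind_assoc_pmf bind_return_pmf)
    (subst (2) bind_commute_pmf, rule refl)

lemma EA_law_eq_CR_law:
  assumes "measurement {- 1, 1 :: int} L" "measurement {- 1, 1 :: int} M"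
    and "stochastic_fun ({- 1, 1} \<times> sign_cube d) U f" "stochastic_fun ({- 1, 1} \<times> sign_cube d) V g"
  obtains f' g' where
    "stochastic_fun (sign_cube (d + 1)) U f'" "stochastic_fun (sign_cube (d + 1)) V g'"
    "EA_law P {- 1, 1} d L M f g = CR_law P d f' g'"
proof -
  obtain k l :: "int \<Rightarrow> int pmf" where kl: "\<forall>z. set_pmf (k z) \<subseteq> {- 1, 1}" "\<forall>z. set_pmf (l z) \<subseteq> {- 1, 1}"
    and eq: "bell_outcomes {- 1, 1} L M =
       bind_pmf (pmf_of_set {- 1, 1}) (\<lambda>z. pair_pmf (k z) (l z))"
    using bell_outcomes_common_bit[OF assms(1,2)] .
  \<comment> \<open>The head of the list is the common bit and the tail the party's own sample. The
    noisy bit drawn from \<open>k\<close> replaces the measurement outcome; it is always a sign, so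
    \<open>f\<close> is called only on its domain.\<close>
  define f' where "f' = (\<lambda>xs. bind_pmf (k (hd xs)) (\<lambda>z. f (z, tl xs)))"
  define g' where "g' = (\<lambda>ys. bind_pmf (l (hd ys)) (\<lambda>z. g (z, tl ys)))"
  have tl: "tl xs \<in> sign_cube d" if "xs \<in> sign_cube (d + 1)" for xs
    using that by (cases xs) (auto simp: sign_cube_def)
  have "stochastic_fun (sign_cube (d + 1)) U f'"
    using assms(3) kl(1) tl by (fastforce simp: stochastic_fun_def f'_def)
  moreover have "stochastic_fun (sign_cube (d + 1)) V g'"
    using assms(4) kl(2) tl by (fastforce simp: stochastic_fun_def g'_def)
  moreover have "EA_law P {- 1, 1} d L M f g = CR_law P d f' g'"
    by (simp add: EA_law_def CR_law_def eq bind_assoc_pmf f'_def g'_def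
        flip: bind_pair_pmf_pair_pmf)
  ultimately show thesis by (rule that)
qed

text \<open>The outcome \<open>1\<close> stands for the first basis vector and every other integer
  for the second, so each value is a projection and the outcomes \<open>1\<close> and
  \<open>- 1\<close> together resolve the identity.\<close>

definition basis_measurement :: "int \<Rightarrow> complex ^ 2 ^ 2" where
  "basis_measurement z = (\<chi> i j. if i = j \<and> (z = 1 \<longleftrightarrow> i = 1) then 1 else 0)"

lemma measurement_basis_measurement: "measurement {- 1, 1} basis_measurement"
proof -
  have "psd_mat (basis_measurement z)" for z
    by (auto simp: psd_mat_def hermitian_mat_def basis_measurement_def cinner_vec_def
        matrix_vector_mult_def sum_2)
  moreover have "(\<Sum>z\<in>{- 1, 1}. basis_measurement z) = mat 1"
    by (auto simp: vec_eq_iff forall_2 basis_measurement_def mat_def)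
  ultimately show ?thesis by (simp add: measurement_def)
qed

text \<open>By \<open>born_value_eq\<close> only entrywise products matter: different projections
  have disjoint supports, and equal ones leave a single entry, of weight one half.\<close>

lemma bell_outcomes_basis_measurement:
  "bell_outcomes {- 1, 1} basis_measurement basis_measurement =
    bind_pmf (pmf_of_set {- 1, 1}) (\<lambda>z. return_pmf (z, z))"
proof (rule pmf_eqI)
  fix x :: "int \<times> int"
  obtain z1 z2 where x: "x = (z1, z2)" by (cases x)
  have "pmf (bell_outcomes {- 1, 1} basis_measurement basis_measurement) x =
      (if z1 \<in> {- 1, 1} \<and> z2 \<in> {- 1, 1}
       then Re (born_value (basis_measurement z1) (basis_measurement z2)) else 0)"
    using arg_cong[OF pmf_bell_outcomes[OF measurement_basis_measurement
          measurement_basis_measurement, of z1 z2], of Re] by (simp add: x)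
  also have "\<dots> = pmf (bind_pmf (pmf_of_set {- 1, 1}) (\<lambda>z. return_pmf (z, z))) x"
    by (auto simp: x pmf_bind_uniform_sign born_value_eq sum_2 basis_measurement_def
        indicator_def)
  finally show "pmf (bell_outcomes {- 1, 1} basis_measurement basis_measurement) x =
      pmf (bind_pmf (pmf_of_set {- 1, 1}) (\<lambda>z. return_pmf (z, z))) x" .
qed

lemma CR_law_eq_EA_law:
  "CR_law P d f g = EA_law P {- 1, 1} d basis_measurement basis_measurement
     (\<lambda>(z, xs). f (z # xs)) (\<lambda>(z, ys). g (z # ys))"
  by (simp add: EA_law_def CR_law_def bell_outcomes_basis_measurement bind_assoc_pmf
      bind_return_pmf)

theorem proposition3:
  fixes P :: "(int \<times> int) pmf"
  assumes "set_pmf P \<subseteq> {-1, 1} \<times> {-1, 1}"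
  shows "P_EA P {-1, 1 :: int} {-1, 1 :: int} {-1, 1 :: int} = P_CR P {-1, 1 :: int} {-1, 1 :: int}"
proof (intro set_eqI iffI)
  fix Q :: "(int \<times> int) pmf"
  assume "Q \<in> P_EA P {-1, 1 :: int} {-1, 1 :: int} {-1, 1 :: int}"
  then obtain L M :: "nat \<Rightarrow> int \<Rightarrow> complex ^ 2 ^ 2" and f g :: "nat \<Rightarrow> int \<times> int list \<Rightarrow> int pmf" where
    Q: "set_pmf Q \<subseteq> {-1, 1} \<times> {-1, 1}"
    and st: "\<And>d. measurement {-1, 1} (L d)" "\<And>d. measurement {-1, 1} (M d)"
      "\<And>d. stochastic_fun ({-1, 1} \<times> sign_cube d) {-1, 1} (f d)"
      "\<And>d. stochastic_fun ({-1, 1} \<times> sign_cube d) {-1, 1} (g d)"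
    and lim: "(\<lambda>d. tv_dist (EA_law P {-1, 1} d (L d) (M d) (f d) (g d)) Q) \<longlonglongrightarrow> 0"
    unfolding P_EA_def by blast
  \<comment> \<open>The laws agree exactly for each \<open>d\<close>, so choosing the kernels
    separately for every \<open>d\<close> leaves the sequence, and hence its limit,
    unchanged.\<close>
  have "\<exists>f' g'. stochastic_fun (sign_cube (d + 1)) {-1, 1} f' \<and>
      stochastic_fun (sign_cube (d + 1)) {-1, 1} g' \<and>
      EA_law P {-1, 1} d (L d) (M d) (f d) (g d) = CR_law P d f' g'" for d
    using EA_law_eq_CR_law[OF st(1-4)[of d]] by blast
  then obtain f' g' where fg': "\<And>d. stochastic_fun (sign_cube (d + 1)) {-1, 1} (f' d)"
    "\<And>d. stochastic_fun (sign_cube (d + 1)) {-1, 1} (g' d)"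
    "\<And>d. EA_law P {-1, 1} d (L d) (M d) (f d) (g d) = CR_law P d (f' d) (g' d)"
    by metis
  show "Q \<in> P_CR P {-1, 1 :: int} {-1, 1 :: int}"
    unfolding P_CR_def using Q fg'(1,2) lim[unfolded fg'(3)]
    by (intro CollectI conjI exI[of _ f'] exI[of _ g'] allI)
next
  fix Q :: "(int \<times> int) pmf"
  assume "Q \<in> P_CR P {-1, 1 :: int} {-1, 1 :: int}"
  then obtain f g :: "nat \<Rightarrow> int list \<Rightarrow> int pmf" where
    Q: "set_pmf Q \<subseteq> {-1, 1} \<times> {-1, 1}"
    and st: "\<And>d. stochastic_fun (sign_cube (d + 1)) {-1, 1} (f d)"
      "\<And>d. stochastic_fun (sign_cube (d + 1)) {-1, 1} (g d)"
    and lim: "(\<lambda>d. tv_dist (CR_law P d (f d) (g d)) Q) \<longlonglongrightarrow> 0"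
    unfolding P_CR_def by blast
  have cons: "stochastic_fun ({-1, 1} \<times> sign_cube d) W (\<lambda>(z, xs). h (z # xs))"
    if "stochastic_fun (sign_cube (d + 1)) W h" for d and W :: "int set" and h
    using that by (auto simp: stochastic_fun_def sign_cube_def)
  show "Q \<in> P_EA P {-1, 1 :: int} {-1, 1 :: int} {-1, 1 :: int}"
    unfolding P_EA_def
    using Q lim[unfolded CR_law_eq_EA_law] cons[OF st(1)] cons[OF st(2)]
      measurement_basis_measurement
    by (intro CollectI conjI exI[of _ "\<lambda>_. basis_measurement"] exI[of _ "\<lambda>d (z, xs). f d (z # xs)"]
        exI[of _ "\<lambda>d (z, ys). g d (z # ys)"] allI) simp_all
qed

end
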